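(* For $z > 0$ let $U(z) = \sup_A f_z(A) \in [0,\infty]$, the supremum over all primitive sets $A \subseteq \{2,3,\ldots\}$. Then: (A) for each $\varepsilon > 0$, $U(z)$ is bounded on $(0, 2-\varepsilon]$; (B) $U(z) = \infty$ for all $z \ge 2$; (C) $\lim_{z \to 2^-} U(z) = \infty$.
   Context: A set $A \subseteq \mathbb{N}$ is primitive if for $a_1, a_2 \in A$, $a_1 \mid a_2$ implies $a_1 = a_2$. For $z > 0$ and $A \subseteq \{2,3,\ldots\}$, $f_z(A) = \sum_{a \in A} \frac{z^{\Omega(a)}}{a(\log a)^z}$ (possibly $+\infty$), where $\Omega(a)$ is the number of prime factors of $a$ counted with multiplicity. *)

theory Defs
  imports "HOL-Analysis.Analysis" "HOL-Computational_Algebra.Primes"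
begin

definition primitive_set :: "nat set \<Rightarrow> bool" where
  "primitive_set A \<longleftrightarrow> (\<forall>a\<^sub>1\<in>A. \<forall>a\<^sub>2\<in>A. a\<^sub>1 dvd a\<^sub>2 \<longrightarrow> a\<^sub>1 = a\<^sub>2)"

definition big_omega :: "nat \<Rightarrow> nat" where
  "big_omega n = size (prime_factorization n)"

(* Intended for z > 0 and A a subset of {2..}, where every summand is positive, so that
   ennreal does not truncate. Every sum in ennreal has a value, so a divergent one is \<infinity>
   (and not 0, as it would be for infsum over the reals). *)
definition f_val :: "real \<Rightarrow> nat set \<Rightarrow> ennreal" where
  "f_val z A = (\<Sum>\<^sub>\<infinity>a\<in>A. ennreal (z ^ big_omega a / (real a * ln (real a) powr z)))"

definition U_sup :: "real \<Rightarrow> ennreal" where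
  "U_sup z = (SUP A\<in>{A. A \<subseteq> {2..} \<and> primitive_set A}. f_val z A)"

end

theory Submission
  imports Defs
begin

text \<open>For the upper bound put \<open>h(n) = z^\<Omega>(n) / n\<close>. Building a number by adjoining its prime factors in
  increasing order makes the positive integers a tree in which every ancestor is a divisor, so a
  primitive set is an antichain. If \<open>z < 2\<close>, the mass \<open>h(n) \<Prod>(1 - z/p)\<close>, over \<open>p\<close> below the largest prime
  factor of \<open>n\<close>, is at least the total mass of any finite set of children, by telescoping. Hence the
  masses add up to at most 1 over an antichain, and Mertens' bound for the product turns this into a
  bound for \<open>f_z\<close>.

  For \<open>z = 2\<close> take numbers \<open>2^j m\<close> with \<open>m\<close> odd and exactly \<open>k\<close> prime factors in total. Here
  \<open>h(2^j m) = h(m)\<close>, and \<open>2^\<Omega>(m)\<close> is at least the number of divisors of \<open>m\<close>, so the sum dominates the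
  sum of \<open>1 / (u v (log(u v) + k log 2)^2)\<close> over pairs of odd numbers below \<open>2^n\<close> with \<open>\<Omega>(u v) \<le> k\<close>.
  Without the last condition this is at least of order \<open>log(n / k)\<close>, and by Rankin's trick the condition
  costs only a constant once \<open>k\<close> is a large multiple of \<open>log n\<close>. Larger \<open>z\<close> are settled by single powers
  of 2, and the limit from the left by continuity of the finite sums.\<close>

section \<open>Sums over primes\<close>

lemma big_omega_mult:
  assumes "m > 0" "n > 0"
  shows "big_omega (m * n) = big_omega m + big_omega n"
  using assms by (simp add: big_omega_def prime_factorization_mult)

lemma big_omega_prime: "prime p \<Longrightarrow> big_omega p = 1"
  by (simp add: big_omega_def prime_factorization_prime)

lemma big_omega_1 [simp]: "big_omega (Suc 0) = 0"
  by (simp add: big_omega_def)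

lemma big_omega_power: "n > 0 \<Longrightarrow> big_omega (n ^ k) = k * big_omega n"
  by (induction k) (auto simp: big_omega_mult)

lemma big_omega_eq_0: "n > 0 \<Longrightarrow> big_omega n = 0 \<Longrightarrow> n = 1"
  by (auto simp: big_omega_def prime_factorization_empty_iff)

text \<open>The cofactor has no prime factors. Consequently a set of positive integers on which
  \<Omega> is constant is primitive.\<close>

lemma big_omega_dvd_eq:
  assumes "a dvd b" "b > 0" "big_omega a = big_omega b"
  shows "a = b"
proof -
  obtain c where c: "b = a * c" using assms(1) by blast
  with assms have "big_omega c = 0" by (simp add: big_omega_mult)
  with c assms show ?thesis using big_omega_eq_0[of c] by auto
qed

text \<open>Adjoining a prime \<open>p\<close> at most doubles the count: a divisor of
  \<open>p * n\<close> divides \<open>n\<close> or is \<open>p\<close> times a divisor of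
  \<open>n\<close>.\<close>

lemma card_divisors_le:
  assumes "n > 0"
  shows "card {d. d dvd n} \<le> 2 ^ big_omega n"
  using assms
proof (induction n rule: prime_divisors_induct)
  case (factor p n)
  have n: "n > 0" using factor.prems by simp
  have p: "prime p" using factor by simp
  have "{d. d dvd p * n} \<subseteq> {d. d dvd n} \<union> (*) p ` {d. d dvd n}"
  proof
    fix d assume "d \<in> {d. d dvd p * n}"
    hence d: "d dvd p * n" by simp
    show "d \<in> {d. d dvd n} \<union> (*) p ` {d. d dvd n}"
    proof (cases "p dvd d")
      case True
      then obtain e where "d = p * e" by blast
      with d p show ?thesis by (auto simp: prime_gt_0_nat)
    next
      case False
      hence "coprime p d" using p by (simp add: prime_imp_coprime)
      hence "d dvd n" using d by (simp add: coprime_commute coprime_dvd_mult_right_iff)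
      thus ?thesis by simp
    qed
  qed
  moreover have fin: "finite {d. d dvd n}" using n by simp
  ultimately have "card {d. d dvd p * n} \<le> card ({d. d dvd n} \<union> (*) p ` {d. d dvd n})"
    by (intro card_mono) auto
  also have "\<dots> \<le> card {d. d dvd n} + card {d. d dvd n}"
    by (rule order.trans[OF card_Un_le]) (intro add_mono card_image_le fin order.refl)
  also have "\<dots> \<le> 2 ^ big_omega (p * n)"
    using factor n p by (simp add: big_omega_mult big_omega_prime prime_gt_0_nat)
  finally show ?case .
qed (auto)

section \<open>Upper bounds of Chebyshev and Mertens type for sums over primes\<close>

abbreviation primes_upto :: "nat \<Rightarrow> nat set" where
  "primes_upto N \<equiv> {p. prime p \<and> p \<le> N}"

lemma finite_primes_upto [simp]: "finite (primes_upto N)"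
  by (rule finite_subset[of _ "{..N}"]) auto

lemma prod_primes_dvd:
  fixes m :: nat
  assumes "finite P" "\<And>p. p \<in> P \<Longrightarrow> prime p" "\<And>p. p \<in> P \<Longrightarrow> p dvd m"
  shows "\<Prod>P dvd m"
  using assms
proof (induction P rule: finite_induct)
  case (insert q P)
  have "coprime q (\<Prod>P)"
    by (rule prod_coprime_right) (use insert in \<open>auto intro!: primes_coprime\<close>)
  with insert show ?case by (auto intro!: divides_mult)
qed simp

text \<open>The product of the distinct primes dividing \<open>m\<close> itself divides
  \<open>m\<close>.\<close>

lemma sum_ln_prime_divisors_le:
  assumes "m > 0"
  shows "(\<Sum>p | prime p \<and> p dvd m. ln (real p)) \<le> ln (real m)"
proof -
  have fin: "finite {p. prime p \<and> p dvd m}"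
    using assms by (simp add: finite_divisors_nat)
  have "(\<Sum>p | prime p \<and> p dvd m. ln (real p)) = ln (\<Prod>p | prime p \<and> p dvd m. real p)"
    by (rule ln_prod[symmetric]) (auto simp: fin prime_gt_0_nat)
  also have "(\<Prod>p | prime p \<and> p dvd m. real p) = real (\<Prod>p | prime p \<and> p dvd m. p)"
    by simp
  also have "(\<Prod>p | prime p \<and> p dvd m. p) dvd m"
    by (rule prod_primes_dvd) (auto simp: fin)
  hence "(\<Prod>p | prime p \<and> p dvd m. p) \<le> m"
    using assms by (rule dvd_imp_le)
  hence "ln (real (\<Prod>p | prime p \<and> p dvd m. p)) \<le> ln (real m)"
    by (subst ln_le_cancel_iff) (auto intro!: prod_pos simp: prime_gt_0_nat assms simp del: of_nat_prod)
  finally show ?thesis .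
qed

text \<open>Double counting of the pairs \<open>p dvd m\<close> with \<open>m \<le> N\<close>, each
  weighted by \<open>ln p\<close>: a prime \<open>p\<close> occurs \<open>N div p\<close> times, and
  each \<open>m\<close> contributes at most \<open>ln N\<close>.\<close>

lemma sum_ln_prime_over_prime_le:
  "(\<Sum>p\<in>primes_upto N. ln (real p) / real p) \<le> 2 * ln (real N)"
proof (cases "N = 0")
  case True
  hence "primes_upto N = {}" by (auto dest: prime_gt_0_nat)
  thus ?thesis using True by simp
next
  case False
  have "(\<Sum>p\<in>primes_upto N. real (N div p) * ln (real p))
      = (\<Sum>p\<in>primes_upto N. \<Sum>m | m \<in> {1..N} \<and> p dvd m. ln (real p))"
  proof (rule sum.cong)
    fix p assume "p \<in> primes_upto N"
    hence p: "p > 0" by (simp add: prime_gt_0_nat)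
    have "bij_betw (\<lambda>k. p * k) {1..N div p} {m. m \<in> {1..N} \<and> p dvd m}"
      by (rule bij_betwI[where g = "\<lambda>m. m div p"])
         (use p in \<open>auto simp: less_eq_div_iff_mult_less_eq mult.commute div_le_mono elim!: dvdE\<close>)
    hence "card {m. m \<in> {1..N} \<and> p dvd m} = N div p"
      using bij_betw_same_card by fastforce
    thus "real (N div p) * ln (real p) = (\<Sum>m | m \<in> {1..N} \<and> p dvd m. ln (real p))"
      by simp
  qed simp
  also have "\<dots> = (\<Sum>m\<in>{1..N}. \<Sum>p | p \<in> primes_upto N \<and> p dvd m. ln (real p))"
    by (rule sum.swap_restrict) auto
  also have "\<dots> = (\<Sum>m\<in>{1..N}. \<Sum>p | prime p \<and> p dvd m. ln (real p))"
    by (intro sum.cong) (auto dest: dvd_imp_le)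
  also have "\<dots> \<le> (\<Sum>m\<in>{1..N}. ln (real N))"
    by (intro sum_mono order.trans[OF sum_ln_prime_divisors_le]) auto
  finally have *: "(\<Sum>p\<in>primes_upto N. real (N div p) * ln (real p)) \<le> real N * ln (real N)"
    by simp
  have "real N * (\<Sum>p\<in>primes_upto N. ln (real p) / real p)
      \<le> (\<Sum>p\<in>primes_upto N. 2 * (real (N div p) * ln (real p)))"
    unfolding sum_distrib_left
  proof (rule sum_mono)
    fix p assume p: "p \<in> primes_upto N"
    hence "p > 0" by (simp add: prime_gt_0_nat)
    \<comment> \<open>Since the quotient is at least 1, rounding \<open>N / p\<close> down loses at
      most a factor 2; this is the 2 in the bound.\<close>
    hence "1 \<le> N div p" "N mod p < p" using p by (auto simp: less_eq_div_iff_mult_less_eq)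
    have "N = p * (N div p) + N mod p" by simp
    also have "\<dots> \<le> p * (N div p) + p * (N div p)"
      using \<open>1 \<le> N div p\<close> \<open>N mod p < p\<close>
      by (intro add_left_mono) (metis less_imp_le mult.right_neutral mult_le_mono2 order.trans)
    finally have "real N \<le> real (2 * (p * (N div p)))" by linarith
    hence "real N / real p \<le> 2 * real (N div p)"
      using \<open>p > 0\<close> by (simp add: field_simps)
    hence "real N / real p * ln (real p) \<le> 2 * real (N div p) * ln (real p)"
      using \<open>p > 0\<close> by (intro mult_right_mono) auto
    thus "real N * (ln (real p) / real p) \<le> 2 * (real (N div p) * ln (real p))" by simp
  qed
  also have "\<dots> \<le> real N * (2 * ln (real N))"
    using * by (simp add: sum_distrib_left[symmetric])
  finally show ?thesis using False by simp
qed

text \<open>One step of the integral test: the right-hand side is the integral of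
  \<open>t powr - (1 + \<delta>)\<close> over \<open>[x, x + 1]\<close>.\<close>

lemma powr_diff_ge:
  fixes x \<delta> :: real
  assumes "x \<ge> 1" "\<delta> > 0"
  shows "(x + 1) powr - (1 + \<delta>) \<le> (x powr - \<delta> - (x + 1) powr - \<delta>) / \<delta>"
proof -
  have "\<exists>u. x < u \<and> u < x + 1 \<and>
      (x + 1) powr - \<delta> - x powr - \<delta> = (x + 1 - x) * (- \<delta> * u powr (- \<delta> - 1))"
    using assms by (intro MVT2) (auto intro!: derivative_eq_intros)
  then obtain u where u: "x < u" "u < x + 1"
    "(x + 1) powr - \<delta> - x powr - \<delta> = - \<delta> * u powr (- \<delta> - 1)"
    by auto
  have "(x + 1) powr (- \<delta> - 1) \<le> u powr (- \<delta> - 1)"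
    using u assms by (intro powr_mono2') auto
  hence "(x + 1) powr (- \<delta> - 1) * \<delta> \<le> u powr (- \<delta> - 1) * \<delta>"
    using assms by (intro mult_right_mono) auto
  also have "\<dots> = x powr - \<delta> - (x + 1) powr - \<delta>"
    using u(3) by (simp add: mult.commute)
  finally have "(x + 1) powr (- \<delta> - 1) * \<delta> \<le> x powr - \<delta> - (x + 1) powr - \<delta>" .
  moreover have "- (1 + \<delta>) = - \<delta> - 1" by simp
  ultimately show ?thesis using assms by (simp only: pos_le_divide_eq)
qed

text \<open>The bound \<open>1 + 1 / \<delta>\<close> for the zeta function at
  \<open>1 + \<delta>\<close>. The induction carries the telescoped remainder, which is dropped at
  the end.\<close>

lemma sum_powr_le:
  fixes S :: "nat set" and \<delta> :: real
  assumes "finite S" "0 \<notin> S" "\<delta> > 0"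
  shows "(\<Sum>n\<in>S. real n powr - (1 + \<delta>)) \<le> 1 + 1 / \<delta>"
proof -
  have *: "(\<Sum>n\<in>{1..Suc M}. real n powr - (1 + \<delta>)) \<le> 1 + (1 - real (Suc M) powr - \<delta>) / \<delta>" for M
  proof (induction M)
    case (Suc M)
    have "real (Suc (Suc M)) powr - (1 + \<delta>) \<le>
        (real (Suc M) powr - \<delta> - real (Suc (Suc M)) powr - \<delta>) / \<delta>"
      using powr_diff_ge[of "real (Suc M)" \<delta>] assms(3) by (simp add: add.commute)
    with Suc show ?case using assms(3) by (simp add: field_simps)
  qed simp
  have "S \<subseteq> {1..Suc (Max (insert 0 S))}"
    using assms by (auto simp: Suc_le_eq intro!: le_SucI intro: gr0I)
  hence "(\<Sum>n\<in>S. real n powr - (1 + \<delta>)) \<le> (\<Sum>n\<in>{1..Suc (Max (insert 0 S))}. real n powr - (1 + \<delta>))"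
    by (intro sum_mono2) auto
  also have "\<dots> \<le> 1 + (1 - real (Suc (Max (insert 0 S))) powr - \<delta>) / \<delta>" by (rule *)
  also have "\<dots> \<le> 1 + 1 / \<delta>" using assms(3) by (simp add: divide_right_mono)
  finally show ?thesis .
qed

text \<open>Expanding the product yields the squarefree numbers composed of primes in
  \<open>P\<close>. The clause on prime factors carries the induction: it keeps \<open>S\<close>
  disjoint from its multiples by a new prime \<open>q\<close>.\<close>

lemma prod_one_plus_le_sum:
  fixes h :: "nat \<Rightarrow> real"
  assumes "finite P" "\<And>p. p \<in> P \<Longrightarrow> prime p"
    and "h 1 = 1" "\<And>m n. h (m * n) = h m * h n"
  shows "\<exists>S. finite S \<and> 0 \<notin> S \<and> (\<forall>n\<in>S. prime_factors n \<subseteq> P) \<and> (\<Prod>p\<in>P. 1 + h p) = (\<Sum>n\<in>S. h n)"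
  using assms(1,2)
proof (induction P rule: finite_induct)
  case empty
  show ?case using assms(3) by (intro exI[of _ "{1}"]) auto
next
  case (insert q P)
  then obtain S where S: "finite S" "0 \<notin> S" "\<forall>n\<in>S. prime_factors n \<subseteq> P"
    "(\<Prod>p\<in>P. 1 + h p) = (\<Sum>n\<in>S. h n)" by auto
  have q: "prime q" "q > 0" using insert by (auto simp: prime_gt_0_nat)
  have "\<not> q dvd n" if "n \<in> S" for n
  proof
    assume "q dvd n"
    moreover have "n \<noteq> 0" using S that by metis
    ultimately have "q \<in> prime_factors n" using q by (simp add: prime_factors_dvd)
    thus False using S that insert by auto
  qed
  hence disj: "S \<inter> (*) q ` S = {}" using dvd_triv_left by blast
  have "(\<Sum>n\<in>S \<union> (*) q ` S. h n) = (\<Sum>n\<in>S. h n) + (\<Sum>n\<in>S. h (q * n))"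
    using S disj q by (simp add: sum.union_disjoint sum.reindex inj_on_def)
  also have "\<dots> = (\<Prod>p\<in>insert q P. 1 + h p)"
    using insert S by (simp add: assms sum_distrib_left algebra_simps)
  finally have "(\<Prod>p\<in>insert q P. 1 + h p) = (\<Sum>n\<in>S \<union> (*) q ` S. h n)" ..
  moreover have "\<forall>n\<in>S \<union> (*) q ` S. prime_factors n \<subseteq> insert q P"
  proof (intro ballI, elim UnE imageE)
    fix n m assume m: "m \<in> S" "n = q * m"
    hence "m \<noteq> 0" using S by metis
    hence "prime_factors n = insert q (prime_factors m)"
      using m q by (simp add: prime_factorization_mult prime_factorization_prime)
    thus "prime_factors n \<subseteq> insert q P" using S m by auto
  qed (use S in auto)
  ultimately show ?case using S q by (intro exI[of _ "S \<union> (*) q ` S"]) auto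
qed

lemma sum_inverse_squares_le:
  assumes "finite S" "0 \<notin> S"
  shows "(\<Sum>n\<in>S. 1 / (real n)\<^sup>2) \<le> 2"
proof -
  have "(\<Sum>n\<in>S. 1 / (real n)\<^sup>2) = (\<Sum>n\<in>S. real n powr - (1 + 1))"
    using assms by (intro sum.cong) (auto simp: powr_minus powr_realpow inverse_eq_divide intro: gr0I)
  also have "\<dots> \<le> 1 + 1 / 1" by (rule sum_powr_le) (use assms in auto)
  finally show ?thesis by simp
qed

text \<open>The expanded product of the \<open>1 + h p\<close> is a partial sum of the zeta function
  at \<open>1 + \<delta>\<close>, hence at most \<open>1 + 1 / \<delta>\<close>. Logarithms and
  \<open>ln (1 + x) \<ge> x - x\<^sup>2\<close> give the claim; the squares account for the
  2.\<close>

lemma sum_prime_powr_le: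
  fixes \<delta> :: real
  assumes "\<delta> > 0"
  shows "(\<Sum>p\<in>primes_upto N. real p powr - (1 + \<delta>)) \<le> ln (1 + 1 / \<delta>) + 2"
proof -
  define h where "h = (\<lambda>n::nat. real n powr - (1 + \<delta>))"
  have "h 1 = 1" "h (m * n) = h m * h n" for m n
    by (simp_all add: h_def powr_mult)
  then obtain S where S: "finite S" "0 \<notin> S" "(\<Prod>p\<in>primes_upto N. 1 + h p) = (\<Sum>n\<in>S. h n)"
    using prod_one_plus_le_sum[OF finite_primes_upto, of N h] by blast
  have h01: "0 \<le> h p" "h p \<le> 1 / real p" if "p \<in> primes_upto N" for p
  proof -
    have p: "real p \<ge> 1" using that prime_gt_0_nat[of p] by auto
    have "h p \<le> real p powr - 1" unfolding h_def using p assms by (intro powr_mono) auto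
    thus "h p \<le> 1 / real p" using p by (simp add: powr_minus inverse_eq_divide)
  qed (simp add: h_def)
  have pos: "0 < 1 + h p" if "p \<in> primes_upto N" for p
    using h01(1)[OF that] by simp
  have "(\<Sum>p\<in>primes_upto N. h p - (h p)\<^sup>2) \<le> (\<Sum>p\<in>primes_upto N. ln (1 + h p))"
  proof (rule sum_mono)
    fix p assume p: "p \<in> primes_upto N"
    have "1 / real p \<le> 1" using p prime_gt_0_nat[of p] by auto
    thus "h p - (h p)\<^sup>2 \<le> ln (1 + h p)"
      using h01[OF p] by (intro ln_one_plus_pos_lower_bound) auto
  qed
  also have "\<dots> = ln (\<Prod>p\<in>primes_upto N. 1 + h p)"
    by (rule ln_prod[symmetric]) (use pos in \<open>auto simp: less_imp_neq[THEN not_sym]\<close>)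
  also have "\<dots> \<le> ln (1 + 1 / \<delta>)"
  proof (subst ln_le_cancel_iff)
    show "(\<Prod>p\<in>primes_upto N. 1 + h p) \<le> 1 + 1 / \<delta>"
      using sum_powr_le[OF S(1,2) assms] by (simp only: S(3)) (simp add: h_def)
    show "0 < (\<Prod>p\<in>primes_upto N. 1 + h p)"
      by (rule prod_pos) (use pos in auto)
  qed (use assms in \<open>auto simp: add_pos_pos\<close>)
  finally have 1: "(\<Sum>p\<in>primes_upto N. h p) \<le> ln (1 + 1 / \<delta>) + (\<Sum>p\<in>primes_upto N. (h p)\<^sup>2)"
    by (simp add: sum_subtractf)
  have "(\<Sum>p\<in>primes_upto N. (h p)\<^sup>2) \<le> (\<Sum>p\<in>primes_upto N. (1 / real p)\<^sup>2)"
    using h01 by (intro sum_mono power_mono) auto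
  also have "\<dots> \<le> 2"
    using sum_inverse_squares_le[of "primes_upto N"] by (auto simp: power_divide)
  finally show ?thesis using 1 by (simp add: h_def)
qed

text \<open>Mertens' upper bound. With \<delta> = 1 / ln N, replacing \<open>1 / p\<close> by
  \<open>p powr - (1 + \<delta>)\<close> costs at most \<open>\<delta> * ln p / p\<close>, because
  \<open>exp (- t) \<ge> 1 - t\<close>; these errors add up to at most 2.\<close>

lemma sum_inverse_primes_le:
  assumes "N \<ge> 2"
  shows "(\<Sum>p\<in>primes_upto N. 1 / real p) \<le> ln (1 + ln (real N)) + 4"
proof -
  define \<delta> where "\<delta> = 1 / ln (real N)"
  have L: "ln (real N) > 0" using assms by simp
  have "(\<Sum>p\<in>primes_upto N. 1 / real p) \<le>
      (\<Sum>p\<in>primes_upto N. real p powr - (1 + \<delta>) + \<delta> * (ln (real p) / real p))"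
  proof (rule sum_mono)
    fix p assume "p \<in> primes_upto N"
    hence p: "p > 0" by (simp add: prime_gt_0_nat)
    have "real p powr - (1 + \<delta>) = real p powr - 1 * real p powr - \<delta>"
      by (subst powr_add[symmetric]) simp
    also have "\<dots> = exp (- (\<delta> * ln (real p))) / real p"
      using p by (simp add: powr_minus_divide powr_one) (simp add: powr_def exp_minus field_simps)
    also have "\<dots> \<ge> (1 - \<delta> * ln (real p)) / real p"
      using exp_ge_add_one_self[of "- (\<delta> * ln (real p))"] by (intro divide_right_mono) auto
    finally show "1 / real p \<le> real p powr - (1 + \<delta>) + \<delta> * (ln (real p) / real p)"
      by (simp add: diff_divide_distrib)
  qed
  also have "\<dots> = (\<Sum>p\<in>primes_upto N. real p powr - (1 + \<delta>))
      + \<delta> * (\<Sum>p\<in>primes_upto N. ln (real p) / real p)"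
    by (simp add: sum.distrib sum_distrib_left)
  also have "\<dots> \<le> (ln (1 + 1 / \<delta>) + 2) + \<delta> * (2 * ln (real N))"
    using L by (intro add_mono mult_left_mono sum_prime_powr_le sum_ln_prime_over_prime_le)
      (auto simp: \<delta>_def)
  also have "\<dots> = ln (1 + ln (real N)) + 4" using L by (simp add: \<delta>_def)
  finally show ?thesis .
qed

section \<open>Antichains and prime cones\<close>

text \<open>Splitting off the multiples of q gives T \<le> F + h q * T for the sum T over the smooth numbers
  up to N, so no infinite geometric series is needed.\<close>

lemma smooth_sum_le_prod:
  fixes h :: "nat \<Rightarrow> real"
  assumes "finite P" "\<And>p. p \<in> P \<Longrightarrow> prime p"
    and "h 1 = 1" "\<And>m n. m > 0 \<Longrightarrow> n > 0 \<Longrightarrow> h (m * n) = h m * h n"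
    and nonneg: "\<And>n. h n \<ge> 0" and less1: "\<And>p. p \<in> P \<Longrightarrow> h p < 1"
  shows "(\<Sum>n | n \<in> {1..N} \<and> prime_factors n \<subseteq> P. h n) \<le> (\<Prod>p\<in>P. 1 / (1 - h p))"
  using assms(1,2) less1
proof (induction P rule: finite_induct)
  case empty
  have "{n. n \<in> {1..N} \<and> prime_factors n \<subseteq> {}} \<subseteq> {1}"
    by (auto simp: prime_factorization_empty_iff)
  hence "(\<Sum>n | n \<in> {1..N} \<and> prime_factors n \<subseteq> {}. h n) \<le> (\<Sum>n\<in>{1}. h n)"
    by (intro sum_mono2) (auto simp: nonneg)
  thus ?case using assms(3) by simp
next
  case (insert q P)
  define S where "S = (\<lambda>P. {n. n \<in> {1..N} \<and> prime_factors n \<subseteq> P})"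
  have fin: "finite (S P)" for P
    by (rule finite_subset[of _ "{1..N}"]) (auto simp: S_def)
  have q: "prime q" "q > 0" using insert by (auto simp: prime_gt_0_nat)
  define T where "T = sum h (S (insert q P))"
  have "S (insert q P) \<subseteq> S P \<union> (*) q ` S (insert q P)"
  proof
    fix n assume n: "n \<in> S (insert q P)"
    show "n \<in> S P \<union> (*) q ` S (insert q P)"
    proof (cases "q dvd n")
      case True
      then obtain m where m: "n = q * m" by blast
      hence "m > 0" using n by (auto simp: S_def intro: gr0I)
      moreover have "m \<le> N"
      proof -
        have "m \<le> q * m" using q by simp
        also have "\<dots> \<le> N" using n m by (simp add: S_def)
        finally show ?thesis .
      qed
      moreover have "prime_factors m \<subseteq> prime_factors n"
        using m q \<open>m > 0\<close> by (intro dvd_prime_factors) auto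
      ultimately have "m \<in> S (insert q P)" using n by (auto simp: S_def)
      thus ?thesis using m by blast
    next
      case False
      hence "q \<notin> prime_factors n" by (simp add: in_prime_factors_iff)
      thus ?thesis using n by (auto simp: S_def)
    qed
  qed
  hence "T \<le> sum h (S P \<union> (*) q ` S (insert q P))"
    unfolding T_def by (intro sum_mono2) (auto simp: fin nonneg)
  also have "\<dots> \<le> sum h (S P) + sum h ((*) q ` S (insert q P))"
    using sum.union_inter[of "S P" "(*) q ` S (insert q P)" h]
      sum_nonneg[of "S P \<inter> (*) q ` S (insert q P)" h] nonneg by (simp add: fin)
  also have "sum h ((*) q ` S (insert q P)) = (\<Sum>n\<in>S (insert q P). h (q * n))"
    using q by (subst sum.reindex) (auto simp: inj_on_def)
  also have "\<dots> = h q * T"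
    unfolding T_def sum_distrib_left
    by (rule sum.cong) (use q in \<open>auto simp: S_def intro!: assms(4)\<close>)
  finally have "T * (1 - h q) \<le> sum h (S P)" by (simp add: algebra_simps)
  also have "\<dots> \<le> (\<Prod>p\<in>P. 1 / (1 - h p))"
    using insert unfolding S_def by simp
  finally have "T \<le> (\<Prod>p\<in>P. 1 / (1 - h p)) / (1 - h q)"
    using insert.prems(2)[of q] by (simp add: pos_le_divide_eq)
  thus ?case using insert by (simp add: T_def S_def mult.commute)
qed

text \<open>When the factors are adjoined in increasing order of the index, the summand at
  \<open>q\<close> is the amount by which the factor \<open>1 - h q\<close> lowers the
  product.\<close>

lemma sum_telescope_primes:
  fixes h :: "nat \<Rightarrow> real"
  assumes "finite Q"
  shows "(\<Sum>q\<in>Q. h q * (\<Prod>p\<in>{p\<in>Q. p < q}. 1 - h p)) = 1 - (\<Prod>p\<in>Q. 1 - h (p::nat))"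
  using assms
proof (induction Q rule: finite_linorder_max_induct)
  case (insert b Q)
  have 1: "{p \<in> insert b Q. p < b} = Q" using insert by auto
  have 2: "b \<notin> Q" using insert by auto
  have "(\<Sum>q\<in>Q. h q * (\<Prod>p\<in>{p\<in>insert b Q. p < q}. 1 - h p))
      = (\<Sum>q\<in>Q. h q * (\<Prod>p\<in>{p\<in>Q. p < q}. 1 - h p))"
    using insert by (intro sum.cong arg_cong2[of _ _ _ _ "(*)"] prod.cong) (auto dest: less_asym)
  thus ?case using insert 1 2 by (simp add: algebra_simps)
qed simp

text \<open>The primes below the largest prime factor, put existentially so that 1 gets the empty
  set.\<close>

definition lower_primes :: "nat \<Rightarrow> nat set" where
  "lower_primes n = {p. prime p \<and> (\<exists>q\<in>prime_factors n. p < q)}"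

text \<open>For \<^term>\<open>h = (\<lambda>n. 1 / n)\<close> this is the density of the set of multiples of \<open>n\<close> whose cofactor has
  only prime factors at least the largest prime factor of \<open>n\<close>.\<close>

definition cone_density :: "(nat \<Rightarrow> real) \<Rightarrow> nat \<Rightarrow> real" where
  "cone_density h n = h n * (\<Prod>p\<in>lower_primes n. 1 - h p)"

text \<open>The subtree rooted at \<open>n\<close>: \<open>n\<close> itself and whatever arises by
  appending primes no smaller than those of \<open>n\<close>.\<close>

definition prime_cone :: "nat \<Rightarrow> nat set" where
  "prime_cone n = {a. a > 0 \<and> (\<exists>m. a = n * m \<and> (\<forall>p\<in>prime_factors n. \<forall>q\<in>prime_factors m. p \<le> q))}"

lemma finite_lower_primes: "finite (lower_primes n)"
proof (rule finite_subset)
  show "lower_primes n \<subseteq> {..n}"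
    by (auto simp: lower_primes_def in_prime_factors_iff dest!: dvd_imp_le)
qed auto

text \<open>The child \<open>n * q\<close> on the path to \<open>a\<close> is found by taking for
  \<open>q\<close> the least prime factor of the cofactor \<open>a / n\<close>.\<close>

lemma prime_cone_split:
  assumes "a \<in> prime_cone n" "a \<noteq> n"
  shows "\<exists>q. prime q \<and> q \<le> a \<and> (\<forall>p\<in>prime_factors n. p \<le> q) \<and> a \<in> prime_cone (n * q)"
proof -
  obtain m where m: "a > 0" "a = n * m" "\<And>p q. p \<in> prime_factors n \<Longrightarrow> q \<in> prime_factors m \<Longrightarrow> p \<le> q"
    using assms(1) by (auto simp: prime_cone_def)
  have m0: "m > 0" "n > 0" using m by (auto intro: gr0I)
  have "m \<noteq> 1" using m assms by auto
  then obtain q0 where "prime q0" "q0 dvd m" by (metis prime_factor_nat)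
  hence ne: "prime_factors m \<noteq> {}" using m0 in_prime_factors_iff[of q0 m] by auto
  define q where "q = Min (prime_factors m)"
  have q: "q \<in> prime_factors m" unfolding q_def using ne by (intro Min_in) auto
  have q_le: "q \<le> r" if "r \<in> prime_factors m" for r
    unfolding q_def using that by (intro Min_le) auto
  obtain k where k: "m = q * k" using q by (auto simp: in_prime_factors_iff)
  have "prime q" using q by (simp add: in_prime_factors_iff)
  hence "q > 0" by (simp add: prime_gt_0_nat)
  have k0: "k > 0" using k m0 by (auto intro: gr0I)
  have sub: "prime_factors k \<subseteq> prime_factors m"
    using k m0 by (intro dvd_prime_factors) auto
  have "prime_factors (n * q) = insert q (prime_factors n)"
    using \<open>prime q\<close> \<open>q > 0\<close> m0 by (simp add: prime_factorization_mult prime_factorization_prime)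
  hence "\<forall>p\<in>prime_factors (n * q). \<forall>r\<in>prime_factors k. p \<le> r"
    using sub q_le m(3) by auto
  hence "a \<in> prime_cone (n * q)"
    using m k by (auto simp: prime_cone_def intro!: exI[of _ k])
  moreover have "q dvd a" using m k by simp
  hence "q \<le> a" using m(1) by (rule dvd_imp_le)
  ultimately show ?thesis using \<open>prime q\<close> m(3) q by blast
qed

text \<open>Induction from the leaves to the root. If \<open>n\<close> lies in \<open>A\<close>,
  primitivity leaves no other element in its cone. Otherwise the sum is distributed over the
  children \<open>n * q\<close>, whose densities telescope to at most that of
  \<open>n\<close>.\<close>

lemma sum_cone_density_le:
  fixes h :: "nat \<Rightarrow> real"
  assumes h_mult: "\<And>m n. m > 0 \<Longrightarrow> n > 0 \<Longrightarrow> h (m * n) = h m * h n"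
    and nonneg: "\<And>n. h n \<ge> 0" and le1: "\<And>p. prime p \<Longrightarrow> h p \<le> 1"
    and A: "A \<subseteq> {1..N}" "primitive_set A" and "n > 0"
  shows "(\<Sum>a | a \<in> A \<and> a \<in> prime_cone n. cone_density h a) \<le> cone_density h n"
  using \<open>n > 0\<close>
proof (induction "Suc N - n" arbitrary: n rule: less_induct)
  case less
  have dens_nonneg: "cone_density h n \<ge> 0" for n
    using nonneg le1 by (auto simp: cone_density_def lower_primes_def intro!: mult_nonneg_nonneg prod_nonneg)
  have "finite A" using A(1) finite_subset by blast
  have cone_dvd: "n dvd a" if "a \<in> prime_cone n" for a n using that by (auto simp: prime_cone_def)
  show ?case
  proof (cases "n \<in> A")
    case True
    hence "{a. a \<in> A \<and> a \<in> prime_cone n} \<subseteq> {n}"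
      using A(2) cone_dvd by (auto simp: primitive_set_def)
    hence "(\<Sum>a | a \<in> A \<and> a \<in> prime_cone n. cone_density h a) \<le> (\<Sum>a\<in>{n}. cone_density h a)"
      by (intro sum_mono2) (auto simp: dens_nonneg)
    thus ?thesis by simp
  next
    case False
    \<comment> \<open>The admissible primes for children; the cutoff \<open>q \<le> N\<close> makes
      the set finite and misses no element of \<open>A\<close>.\<close>
    define Q where "Q = {q. prime q \<and> q \<le> N \<and> (\<forall>p\<in>prime_factors n. p \<le> q)}"
    have finQ: "finite Q" by (rule finite_subset[of _ "{..N}"]) (auto simp: Q_def)
    \<comment> \<open>It is enough that each \<open>a\<close> lies in some child cone: counting it
      repeatedly could only enlarge the right-hand side.\<close>
    have "(\<Sum>a | a \<in> A \<and> a \<in> prime_cone n. cone_density h a)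
        \<le> (\<Sum>a | a \<in> A \<and> a \<in> prime_cone n. \<Sum>q | q \<in> Q \<and> a \<in> prime_cone (n * q). cone_density h a)"
    proof (rule sum_mono)
      fix a assume a: "a \<in> {a. a \<in> A \<and> a \<in> prime_cone n}"
      then obtain q where "prime q" "q \<le> a" "\<forall>p\<in>prime_factors n. p \<le> q" "a \<in> prime_cone (n * q)"
        using prime_cone_split[of a n] False by auto
      hence "q \<in> {q. q \<in> Q \<and> a \<in> prime_cone (n * q)}" using a A(1) by (auto simp: Q_def)
      thus "cone_density h a \<le> (\<Sum>q | q \<in> Q \<and> a \<in> prime_cone (n * q). cone_density h a)"
        using finQ by (intro member_le_sum) (auto simp: dens_nonneg)
    qed
    also have "\<dots> \<le> (\<Sum>a\<in>A. \<Sum>q | q \<in> Q \<and> a \<in> prime_cone (n * q). cone_density h a)"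
      using \<open>finite A\<close> by (intro sum_mono2) (auto intro!: mult_nonneg_nonneg dens_nonneg)
    also have "\<dots> = (\<Sum>q\<in>Q. \<Sum>a | a \<in> A \<and> a \<in> prime_cone (n * q). cone_density h a)"
      by (rule sum.swap_restrict) (use \<open>finite A\<close> finQ in auto)
    also have "\<dots> \<le> (\<Sum>q\<in>Q. cone_density h (n * q))"
    proof (rule sum_mono)
      fix q assume "q \<in> Q"
      hence q: "q \<ge> 2" "prime q" by (auto simp: Q_def prime_ge_2_nat)
      show "(\<Sum>a | a \<in> A \<and> a \<in> prime_cone (n * q). cone_density h a) \<le> cone_density h (n * q)"
      \<comment> \<open>For \<open>n > N\<close> the truncated measure is already 0 and cannot
        decrease, but then no multiple of \<open>n\<close> lies in \<open>A\<close>.\<close>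
      proof (cases "n \<le> N")
        case True
        have "n * 2 \<le> n * q" using q by (intro mult_left_mono) auto
        hence "Suc N - n * q < Suc N - n" using True less.prems by linarith
        thus ?thesis using less.hyps[of "n * q"] less.prems q by (simp add: prime_gt_0_nat)
      next
        case False
        have "a \<notin> prime_cone (n * q)" if "a \<in> A" for a
        proof
          assume "a \<in> prime_cone (n * q)"
          hence "n dvd a" "a > 0" using cone_dvd dvd_mult_left by (blast, auto simp: prime_cone_def)
          hence "n \<le> a" by (rule dvd_imp_le)
          thus False using that A(1) False by auto
        qed
        hence "{a. a \<in> A \<and> a \<in> prime_cone (n * q)} = {}" by blast
        thus ?thesis by (simp only: sum.empty dens_nonneg)
      qed
    qed
    also have "\<dots> = (\<Sum>q\<in>Q. cone_density h n * (h q * (\<Prod>p\<in>{p\<in>Q. p < q}. 1 - h p)))"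
    proof (rule sum.cong)
      fix q assume qQ: "q \<in> Q"
      hence q: "prime q" "q > 0" by (auto simp: Q_def prime_gt_0_nat)
      have "prime_factors (n * q) = insert q (prime_factors n)"
        using q less.prems by (simp add: prime_factorization_mult prime_factorization_prime)
      hence "lower_primes (n * q) = {p. prime p \<and> p < q}"
        using qQ by (auto simp: lower_primes_def Q_def intro: less_le_trans)
      \<comment> \<open>A prime below \<open>q\<close> is either smaller than some prime factor of
        \<open>n\<close> or at least as large as all of them, hence in \<open>Q\<close>. This splits
        the density of \<open>n * q\<close> into that of \<open>n\<close> and a telescoping
        summand.\<close>
      also have "\<dots> = lower_primes n \<union> {p\<in>Q. p < q}"
      proof (intro equalityI subsetI)
        fix p assume p: "p \<in> {p. prime p \<and> p < q}"
        show "p \<in> lower_primes n \<union> {p\<in>Q. p < q}"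
        proof (cases "\<exists>r\<in>prime_factors n. p < r")
          case False
          thus ?thesis using p qQ by (simp add: Q_def not_less)
        qed (use p in \<open>simp add: lower_primes_def\<close>)
      next
        fix p assume "p \<in> lower_primes n \<union> {p\<in>Q. p < q}"
        thus "p \<in> {p. prime p \<and> p < q}"
        proof
          assume "p \<in> lower_primes n"
          then obtain r where "prime p" "r \<in> prime_factors n" "p < r"
            by (auto simp: lower_primes_def)
          thus ?thesis using qQ less_le_trans[of p r q] by (simp add: Q_def)
        qed (simp add: Q_def)
      qed
      finally have eq: "lower_primes (n * q) = lower_primes n \<union> {p\<in>Q. p < q}" .
      have disj: "lower_primes n \<inter> {p\<in>Q. p < q} = {}"
        unfolding lower_primes_def Q_def using not_less by blast
      show "cone_density h (n * q) = cone_density h n * (h q * (\<Prod>p\<in>{p\<in>Q. p < q}. 1 - h p))"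
        using finQ finite_lower_primes[of n] disj q less.prems
        by (simp add: cone_density_def eq prod.union_disjoint h_mult)
    qed simp
    also have "\<dots> = cone_density h n * (1 - (\<Prod>p\<in>Q. 1 - h p))"
      by (simp only: sum_distrib_left[symmetric] sum_telescope_primes[OF finQ])
    also have "\<dots> \<le> cone_density h n * 1"
      using le1 by (intro mult_left_mono dens_nonneg) (auto simp: Q_def intro!: prod_nonneg)
    finally show ?thesis by simp
  qed
qed

text \<open>The cone of 1 is the whole tree, and its density is 1.\<close>

lemma sum_cone_density_le_1:
  fixes h :: "nat \<Rightarrow> real"
  assumes "h 1 = 1" "\<And>m n. m > 0 \<Longrightarrow> n > 0 \<Longrightarrow> h (m * n) = h m * h n"
    and "\<And>n. h n \<ge> 0" "\<And>p. prime p \<Longrightarrow> h p \<le> 1"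
    and "finite A" "0 \<notin> A" "primitive_set A"
  shows "(\<Sum>a\<in>A. cone_density h a) \<le> 1"
proof -
  have "A \<subseteq> {1..Max (insert 0 A)}" using assms(5,6) by (auto simp: Suc_le_eq intro: gr0I)
  hence "(\<Sum>a | a \<in> A \<and> a \<in> prime_cone 1. cone_density h a) \<le> cone_density h 1"
    by (intro sum_cone_density_le) (use assms in auto)
  moreover have "{a. a \<in> A \<and> a \<in> prime_cone 1} = A"
    using assms(6) by (auto simp: prime_cone_def intro: gr0I)
  moreover have "cone_density h 1 = 1" using assms(1) by (simp add: cone_density_def lower_primes_def)
  ultimately show ?thesis by simp
qed

section \<open>The bound for exponents below 2\<close>

definition weight :: "real \<Rightarrow> nat \<Rightarrow> real" where
  "weight z n = z ^ big_omega n / real n"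

lemma weight_1: "weight z 1 = 1"
  by (simp add: weight_def)

lemma weight_mult: "m > 0 \<Longrightarrow> n > 0 \<Longrightarrow> weight z (m * n) = weight z m * weight z n"
  by (simp add: weight_def big_omega_mult power_add)

lemma weight_nonneg: "z \<ge> 0 \<Longrightarrow> weight z n \<ge> 0"
  by (simp add: weight_def)

lemma weight_prime: "prime p \<Longrightarrow> weight z p = z / real p"
  by (simp add: weight_def big_omega_prime)

text \<open>Up to 2/3 one has \<open>1 / (1 - x) \<le> 1 + x + 3 * x\<^sup>2\<close>. This range
  contains \<open>z / p\<close> for \<open>z \<le> 2\<close> and odd primes
  \<open>p\<close>.\<close>

lemma one_minus_ge_exp:
  fixes x :: real
  assumes "0 \<le> x" "x \<le> 2 / 3"
  shows "1 - x \<ge> exp (- x - 3 * x\<^sup>2)"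
proof -
  have "1 / (1 - x) \<le> 1 + (x + 3 * x\<^sup>2)"
  proof -
    have "(1 + (x + 3 * x\<^sup>2)) * (1 - x) - 1 = x\<^sup>2 * (2 - 3 * x)"
      by (simp add: algebra_simps power2_eq_square)
    also have "\<dots> \<ge> 0" using assms by simp
    finally show ?thesis using assms by (simp add: pos_divide_le_eq)
  qed
  also have "\<dots> \<le> exp (x + 3 * x\<^sup>2)" by (rule exp_ge_add_one_self)
  finally have "1 \<le> exp (x + 3 * x\<^sup>2) * (1 - x)" using assms by (simp add: pos_divide_le_eq)
  hence "exp (- (x + 3 * x\<^sup>2)) * 1 \<le> exp (- (x + 3 * x\<^sup>2)) * (exp (x + 3 * x\<^sup>2) * (1 - x))"
    by (intro mult_left_mono) auto
  also have "\<dots> = 1 - x" by (simp add: mult.assoc[symmetric] exp_add[symmetric])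
  finally show ?thesis by simp
qed

text \<open>Exponentiated Mertens bound. The prime 2 is set apart because \<open>1 - z / 2\<close>
  vanishes at \<open>z = 2\<close>. In the constant 32, the 4 of Mertens' bound gives
  \<open>4 * z \<le> 8\<close> and the squares give \<open>12 * 2\<close>.\<close>

lemma prod_odd_primes_ge:
  fixes z :: real
  assumes "0 \<le> z" "z \<le> 2" "N \<ge> 2"
  shows "(\<Prod>p\<in>primes_upto N - {2}. 1 - z / real p) \<ge> exp (- 32) * (1 + ln (real N)) powr - z"
proof -
  let ?P = "primes_upto N - {2}"
  have L: "0 \<le> ln (real N)" using assms by simp
  have "(\<Sum>p\<in>?P. z / real p + 3 * (z / real p)\<^sup>2)
      \<le> (\<Sum>p\<in>?P. z * (1 / real p) + 12 * (1 / (real p)\<^sup>2))"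
  proof (rule sum_mono)
    fix p assume "p \<in> ?P"
    have "z\<^sup>2 \<le> 2\<^sup>2" using assms by (intro power_mono) auto
    hence "3 * z\<^sup>2 / (real p)\<^sup>2 \<le> 12 / (real p)\<^sup>2" by (intro divide_right_mono) auto
    thus "z / real p + 3 * (z / real p)\<^sup>2 \<le> z * (1 / real p) + 12 * (1 / (real p)\<^sup>2)"
      by (simp add: power_divide)
  qed
  also have "\<dots> = z * (\<Sum>p\<in>?P. 1 / real p) + 12 * (\<Sum>p\<in>?P. 1 / (real p)\<^sup>2)"
    by (simp add: sum.distrib sum_distrib_left)
  also have "\<dots> \<le> z * (\<Sum>p\<in>primes_upto N. 1 / real p) + 12 * 2"
    using assms by (intro add_mono mult_left_mono sum_mono2 sum_inverse_squares_le) auto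
  also have "\<dots> \<le> z * (ln (1 + ln (real N)) + 4) + 24"
    using assms sum_inverse_primes_le[of N] by (simp add: mult_left_mono)
  also have "\<dots> \<le> z * ln (1 + ln (real N)) + 32"
    using assms by (simp add: algebra_simps)
  finally have "exp (- (z * ln (1 + ln (real N)) + 32))
      \<le> exp (- (\<Sum>p\<in>?P. z / real p + 3 * (z / real p)\<^sup>2))" by simp
  also have "\<dots> = (\<Prod>p\<in>?P. exp (- (z / real p) - 3 * (z / real p)\<^sup>2))"
    by (simp add: exp_sum[symmetric] sum_negf[symmetric])
  also have "\<dots> \<le> (\<Prod>p\<in>?P. 1 - z / real p)"
  proof (rule prod_mono)
    fix p assume p: "p \<in> ?P"
    hence "p \<noteq> 2" "p \<ge> 2" by (auto simp: prime_ge_2_nat)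
    hence "p \<ge> 3" by linarith
    hence "z / real p \<le> 2 / 3" using assms by (intro frac_le) auto
    thus "0 \<le> exp (- (z / real p) - 3 * (z / real p)\<^sup>2) \<and>
        exp (- (z / real p) - 3 * (z / real p)\<^sup>2) \<le> 1 - z / real p"
      using one_minus_ge_exp[of "z / real p"] assms by simp
  qed
  also have "exp (- (z * ln (1 + ln (real N)) + 32)) = exp (- 32) * (1 + ln (real N)) powr - z"
    using L by (simp add: powr_def exp_add[symmetric] add_pos_nonneg)
  finally show ?thesis .
qed

text \<open>The prime 2 contributes a factor of at least \<open>\<epsilon> / 2\<close>, the odd
  primes Mertens' bound. Passing from \<open>1 + ln a\<close> to \<open>3 * ln a\<close> costs at
  most \<open>3\<^sup>2 = 9\<close>, whence \<open>18 = 2 * 9\<close>.\<close>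

lemma cone_density_ge:
  assumes z: "0 < z" "z \<le> 2 - \<epsilon>" and \<epsilon>: "\<epsilon> > 0" and "a \<ge> 2"
  shows "weight z a / ln (real a) powr z \<le> 18 * exp 32 / \<epsilon> * cone_density (weight z) a"
proof -
  have zp: "0 \<le> 1 - z / real p" "1 - z / real p \<le> 1" if "prime p" for p
    using prime_ge_2_nat[OF that] z \<epsilon> by (auto simp: field_simps)
  have two: "2 \<in> primes_upto a" using assms by simp
  have ln2: "ln 2 \<ge> (1 / 2 :: real)" using ln_le_minus_one[of "1 / 2 :: real"] by (simp add: ln_div)
  have La: "ln (real a) \<ge> ln 2" using assms by simp
  have "1 + ln (real a) \<le> 3 * ln (real a)" using ln2 La by simp
  hence "(3 * ln (real a)) powr - z \<le> (1 + ln (real a)) powr - z"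
    using ln2 La z by (intro powr_mono2') auto
  moreover have "(3 * ln (real a)) powr - z = 3 powr - z * ln (real a) powr - z"
    using ln2 La by (simp add: powr_mult)
  moreover have "(3 :: real) powr - 2 \<le> 3 powr - z" using z \<epsilon> by (intro powr_mono) auto
  moreover have "(3 :: real) powr - 2 = 1 / 9" by (simp add: powr_minus inverse_eq_divide)
  ultimately have "1 / 9 * ln (real a) powr - z \<le> (1 + ln (real a)) powr - z"
    by (smt (verit) mult_right_mono powr_ge_zero)
  hence "exp (- 32) * (1 / 9 * ln (real a) powr - z) \<le> exp (- 32) * (1 + ln (real a)) powr - z"
    by (intro mult_left_mono) auto
  also have "\<dots> \<le> (\<Prod>p\<in>primes_upto a - {2}. 1 - z / real p)"
    using assms by (intro prod_odd_primes_ge) auto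
  finally have "\<epsilon> / 2 * (exp (- 32) * (1 / 9 * ln (real a) powr - z))
      \<le> (1 - z / 2) * (\<Prod>p\<in>primes_upto a - {2}. 1 - z / real p)"
    using z \<epsilon> by (intro mult_mono) auto
  also have "\<dots> = (\<Prod>p\<in>primes_upto a. 1 - z / real p)"
    using two by (subst prod.remove[of _ 2]) auto
  \<comment> \<open>Every factor lies in \<open>[0, 1]\<close>, so the smaller set of primes has the
    larger product.\<close>
  also have "\<dots> \<le> (\<Prod>p\<in>lower_primes a. 1 - z / real p)"
  proof -
    have sub: "lower_primes a \<subseteq> primes_upto a"
    proof
      fix p assume "p \<in> lower_primes a"
      then obtain q where "prime p" "q dvd a" "p < q"
        by (auto simp: lower_primes_def in_prime_factors_iff)
      moreover from this have "q \<le> a" using assms by (intro dvd_imp_le) auto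
      ultimately show "p \<in> primes_upto a" by simp
    qed
    have "(\<Prod>p\<in>primes_upto a. 1 - z / real p)
        = (\<Prod>p\<in>primes_upto a - lower_primes a. 1 - z / real p) * (\<Prod>p\<in>lower_primes a. 1 - z / real p)"
      by (rule prod.subset_diff[OF sub]) simp
    also have "\<dots> \<le> 1 * (\<Prod>p\<in>lower_primes a. 1 - z / real p)"
      using zp by (intro mult_right_mono prod_le_1 prod_nonneg) (auto simp: lower_primes_def)
    finally show ?thesis by simp
  qed
  also have "\<dots> = (\<Prod>p\<in>lower_primes a. 1 - weight z p)"
    by (intro prod.cong) (auto simp: lower_primes_def weight_prime)
  finally have "weight z a * (\<epsilon> / 2 * (exp (- 32) * (1 / 9 * ln (real a) powr - z)))
      \<le> cone_density (weight z) a"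
    unfolding cone_density_def using z by (intro mult_left_mono weight_nonneg) auto
  thus ?thesis using \<epsilon> ln2 La by (simp add: powr_minus exp_minus field_simps)
qed

text \<open>In \<open>ennreal\<close> it suffices to bound the finite partial sums, and subsets of a
  primitive set are primitive.\<close>

lemma f_val_le:
  assumes z: "0 < z" "z \<le> 2 - \<epsilon>" and \<epsilon>: "\<epsilon> > 0" and A: "A \<subseteq> {2..}" "primitive_set A"
  shows "f_val z A \<le> ennreal (18 * exp 32 / \<epsilon>)"
  unfolding f_val_def
proof (rule infsum_le_finite_sums)
  fix F assume F: "finite F" "F \<subseteq> A"
  have F2: "a \<ge> 2" if "a \<in> F" for a using F A that by auto
  have "weight z p \<le> 1" if "prime p" for p
    using prime_ge_2_nat[OF that] that z \<epsilon> by (simp add: weight_prime field_simps)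
  moreover have "primitive_set F" using F(2) A(2) unfolding primitive_set_def by blast
  moreover have "0 \<notin> F" using F2[of 0] by auto
  ultimately have *: "(\<Sum>a\<in>F. cone_density (weight z) a) \<le> 1"
    using F(1) z by (intro sum_cone_density_le_1 weight_1 weight_mult weight_nonneg) auto
  have "(\<Sum>a\<in>F. z ^ big_omega a / (real a * ln (real a) powr z))
      = (\<Sum>a\<in>F. weight z a / ln (real a) powr z)"
    by (simp add: weight_def)
  also have "\<dots> \<le> (\<Sum>a\<in>F. 18 * exp 32 / \<epsilon> * cone_density (weight z) a)"
    using z \<epsilon> F2 by (intro sum_mono cone_density_ge)
  also have "\<dots> = 18 * exp 32 / \<epsilon> * (\<Sum>a\<in>F. cone_density (weight z) a)"
    by (simp add: sum_distrib_left)
  also have "\<dots> \<le> 18 * exp 32 / \<epsilon> * 1"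
    using * \<epsilon> by (intro mult_left_mono) auto
  finally show "(\<Sum>a\<in>F. ennreal (z ^ big_omega a / (real a * ln (real a) powr z))) \<le> ennreal (18 * exp 32 / \<epsilon>)"
    using z by (subst sum_ennreal) (auto intro!: ennreal_leI)
qed (rule nonneg_summable_on_complete, simp)

section \<open>Divergence at exponent 2\<close>

definition odds_below :: "nat \<Rightarrow> nat set" where
  "odds_below N = {u. odd u \<and> u < N}"

lemma finite_odds_below [simp]: "finite (odds_below N)"
  by (simp add: odds_below_def)

lemma odds_below_pos: "u \<in> odds_below N \<Longrightarrow> u > 0"
  by (auto simp: odds_below_def intro: gr0I)

text \<open>Comparison with the Euler product over odd primes. Any fixed power of \<open>n\<close>
  would serve, since Rankin's trick later gains a power of 2.\<close>

lemma sum_weight_odds_le: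
  assumes "n \<ge> 1"
  shows "(\<Sum>u\<in>odds_below (2 ^ n). weight 2 u) \<le> exp 24 * (real n + 1) ^ 6"
proof -
  define N where "N = (2::nat) ^ n"
  have "2 ^ 1 \<le> N" unfolding N_def using assms by (intro power_increasing) auto
  hence N: "N \<ge> 2" by simp
  define P where "P = primes_upto N - {2}"
  have p3: "p \<ge> 3" if "p \<in> P" for p
  proof -
    have "p \<noteq> 2" "p \<ge> 2" using that by (auto simp: P_def prime_ge_2_nat)
    thus ?thesis by linarith
  qed
  have lnN: "0 \<le> ln (real N)" "ln (real N) \<le> real n"
    using ln_le_minus_one[of "2 :: real"] N mult_left_mono[of "ln 2" 1 "real n"]
    by (auto simp: N_def ln_realpow)
  have "odds_below N \<subseteq> {u. u \<in> {1..N} \<and> prime_factors u \<subseteq> P}"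
  proof
    fix u assume u: "u \<in> odds_below N"
    have "p \<in> P" if "p \<in> prime_factors u" for p
    proof -
      have "p dvd u" "prime p" using that by (auto simp: in_prime_factors_iff)
      moreover have "p \<le> u" using \<open>p dvd u\<close> odds_below_pos[OF u] by (rule dvd_imp_le)
      moreover have "p \<noteq> 2" using u \<open>p dvd u\<close> by (auto simp: odds_below_def)
      ultimately show ?thesis using u by (simp add: P_def odds_below_def)
    qed
    thus "u \<in> {u. u \<in> {1..N} \<and> prime_factors u \<subseteq> P}"
      using u odds_below_pos[OF u] by (auto simp: odds_below_def)
  qed
  hence "(\<Sum>u\<in>odds_below N. weight 2 u) \<le> (\<Sum>u | u \<in> {1..N} \<and> prime_factors u \<subseteq> P. weight 2 u)"
    by (intro sum_mono2) (auto simp: weight_nonneg)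
  also have "\<dots> \<le> (\<Prod>p\<in>P. 1 / (1 - weight 2 p))"
  proof (rule smooth_sum_le_prod)
    fix p assume "p \<in> P"
    thus "weight 2 p < 1" using p3[of p] by (simp add: P_def weight_prime)
  qed (auto simp: P_def weight_1[unfolded One_nat_def] weight_mult weight_nonneg)
  also have "\<dots> \<le> (\<Prod>p\<in>P. exp (6 * (1 / real p)))"
  proof (rule prod_mono)
    fix p assume p: "p \<in> P"
    \<comment> \<open>The constant 6 gives equality at \<open>p = 3\<close>.\<close>
    have "1 / (1 - 2 / real p) \<le> 1 + 6 * (1 / real p)"
      using p3[OF p] by (simp add: field_simps)
    also have "\<dots> \<le> exp (6 * (1 / real p))" by (rule exp_ge_add_one_self)
    finally show "0 \<le> 1 / (1 - weight 2 p) \<and> 1 / (1 - weight 2 p) \<le> exp (6 * (1 / real p))"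
      using p p3[OF p] by (simp add: P_def weight_prime)
  qed
  also have "\<dots> = exp (6 * (\<Sum>p\<in>P. 1 / real p))"
    by (simp add: exp_sum[symmetric] sum_distrib_left P_def)
  also have "(\<Sum>p\<in>P. 1 / real p) \<le> (\<Sum>p\<in>primes_upto N. 1 / real p)"
    by (rule sum_mono2) (auto simp: P_def)
  also have "\<dots> \<le> ln (1 + ln (real N)) + 4"
    by (rule sum_inverse_primes_le[OF N])
  also have "exp (6 * (ln (1 + ln (real N)) + 4)) = exp 24 * exp (ln (1 + ln (real N))) ^ 6"
    by (simp add: exp_add[symmetric] exp_of_nat_mult[symmetric] algebra_simps)
  also have "\<dots> = exp 24 * (1 + ln (real N)) ^ 6" using lnN by (subst exp_ln) auto
  also have "\<dots> \<le> exp 24 * (real n + 1) ^ 6"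
    using lnN by (intro mult_left_mono power_mono) auto
  finally show ?thesis by (simp add: N_def)
qed

text \<open>For \<open>m \<ge> 1\<close> the block has at least \<open>2 ^ (m - 1)\<close> odd
  members, each with reciprocal at least \<open>1 / 2 ^ (m + 1)\<close>.\<close>

lemma sum_inverse_odd_block_ge:
  "(\<Sum>u | odd u \<and> 2 ^ m \<le> u \<and> u < 2 ^ Suc m. 1 / real u) \<ge> 1 / 4"
proof (cases m)
  case 0
  hence "{u::nat. odd u \<and> 2 ^ m \<le> u \<and> u < 2 ^ Suc m} = {1}" by auto
  thus ?thesis by simp
next
  case (Suc j)
  let ?B = "{u::nat. odd u \<and> 2 ^ m \<le> u \<and> u < 2 ^ Suc m}"
  have "(\<lambda>t. 2 ^ m + 2 * t + 1) ` {..<2 ^ j} \<subseteq> ?B" using Suc by auto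
  hence "card ((\<lambda>t::nat. 2 ^ m + 2 * t + 1) ` {..<2 ^ j}) \<le> card ?B"
    by (intro card_mono) auto
  hence "2 ^ j \<le> card ?B" by (simp add: card_image inj_on_def)
  hence "real (2 ^ j) \<le> real (card ?B)" by (rule of_nat_mono)
  hence "1 / 4 \<le> real (card ?B) * (1 / 2 ^ Suc m)"
    using Suc by (simp add: field_simps)
  also have "\<dots> = (\<Sum>u\<in>?B. 1 / 2 ^ Suc m)" by simp
  also have "\<dots> \<le> (\<Sum>u\<in>?B. 1 / real u)"
  proof (rule sum_mono)
    fix u assume u: "u \<in> ?B"
    hence "real u \<le> real (2 ^ Suc m)" by (intro of_nat_mono) auto
    moreover have "u > 0" using u by (auto intro: gr0I)
    ultimately show "1 / 2 ^ Suc m \<le> 1 / real u" by (intro frac_le) auto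
  qed
  finally show ?thesis .
qed

lemma odds_below_power_Suc:
  "odds_below (2 ^ Suc m) = odds_below (2 ^ m) \<union> {u. odd u \<and> 2 ^ m \<le> u \<and> u < 2 ^ Suc m}"
  "odds_below (2 ^ m) \<inter> {u. odd u \<and> 2 ^ m \<le> u \<and> u < 2 ^ Suc m} = {}"
  by (auto simp: odds_below_def)

lemma sum_inverse_odds_ge: "(\<Sum>u\<in>odds_below (2 ^ m). 1 / real u) \<ge> real m / 4"
proof (induction m)
  case (Suc m)
  have "(\<Sum>u\<in>odds_below (2 ^ Suc m). 1 / real u) = (\<Sum>u\<in>odds_below (2 ^ m). 1 / real u)
      + (\<Sum>u | odd u \<and> 2 ^ m \<le> u \<and> u < 2 ^ Suc m. 1 / real u)"
    unfolding odds_below_power_Suc(1) by (rule sum.union_disjoint) (auto simp: odds_below_def)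
  thus ?case using Suc sum_inverse_odd_block_ge[of m] by simp
qed (simp add: sum_nonneg)

text \<open>With \<open>m = u * v\<close>, the bracket bounds the logarithm of
  \<open>2 ^ (k - \<Omega>(m)) * m\<close> from above without involving \<Omega>.\<close>

definition pair_term :: "nat \<Rightarrow> nat \<Rightarrow> nat \<Rightarrow> real" where
  "pair_term k u v = 1 / (real (u * v) * (ln (real (u * v)) + real k * ln 2)\<^sup>2)"

lemma pair_term_nonneg: "pair_term k u v \<ge> 0"
  by (simp add: pair_term_def)

lemma ln2_bounds: "1 / 2 \<le> ln (2::real)" "ln (2::real) \<le> 1"
  using ln_le_minus_one[of "1 / 2 :: real"] ln_le_minus_one[of "2 :: real"] by (simp_all add: ln_div)

text \<open>Passing from \<open>n\<close> to \<open>n + 1\<close> adds the pairs with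
  \<open>u\<close> in the new dyadic block. They contribute at least
  \<open>1/4 * n/4 / (25 * n\<^sup>2) = 1 / (400 * n)\<close>, which dominates the increment of the
  logarithm.\<close>

lemma sum_pair_term_ge:
  assumes "k \<ge> 1" "n \<ge> k"
  shows "(\<Sum>u\<in>odds_below (2 ^ n). \<Sum>v\<in>odds_below (2 ^ n). pair_term k u v)
      \<ge> (ln (real n) - ln (real k)) / 400"
  using assms(2)
proof (induction n rule: dec_induct)
  case base
  show ?case by (simp add: sum_nonneg pair_term_nonneg)
next
  case (step n)
  let ?O = "\<lambda>n. odds_below (2 ^ n)"
  let ?B = "{u::nat. odd u \<and> 2 ^ n \<le> u \<and> u < 2 ^ Suc n}"
  have n: "n \<ge> 1" using assms step by simp
  have term_ge: "pair_term k u v \<ge> 1 / real u * (1 / real v) * (1 / (25 * (real n)\<^sup>2))"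
    if "u \<in> ?O (Suc n)" "v \<in> ?O (Suc n)" for u v
  proof -
    have uv: "u > 0" "v > 0" using that odds_below_pos by auto
    have "ln (real u) \<le> ln (real (2 ^ Suc n))" "ln (real v) \<le> ln (real (2 ^ Suc n))"
      using that uv by (auto simp: odds_below_def simp del: power_Suc of_nat_power)
    moreover have "ln (real (2 ^ Suc n)) = real (Suc n) * ln 2"
      by (simp add: ln_realpow del: power_Suc)
    ultimately have "ln (real (u * v)) + real k * ln 2 \<le> (2 * real (Suc n) + real k) * ln 2"
      using uv by (simp add: ln_mult algebra_simps)
    also have "\<dots> \<le> (2 * real (Suc n) + real k) * 1"
      using ln2_bounds by (intro mult_left_mono) auto
    \<comment> \<open>From \<open>k \<le> n\<close> and \<open>n \<ge> 1\<close>: the left side is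
      at most \<open>3 * n + 2\<close>.\<close>
    also have "\<dots> \<le> 5 * real n" using n step by simp
    finally have "(ln (real (u * v)) + real k * ln 2)\<^sup>2 \<le> (5 * real n)\<^sup>2"
      using uv by (intro power_mono) (auto simp: ln_mult intro!: add_nonneg_nonneg)
    moreover have "0 < ln (real (u * v)) + real k * ln 2"
      using uv assms(1) by (auto simp: ln_mult intro!: add_nonneg_pos)
    ultimately have "1 / (real (u * v) * (25 * (real n)\<^sup>2)) \<le> pair_term k u v"
      unfolding pair_term_def using uv n
      by (intro divide_left_mono mult_left_mono mult_pos_pos) (auto simp: power_mult_distrib)
    thus ?thesis by simp
  qed
  have "ln (real (Suc n)) - ln (real n) = ln (1 + 1 / real n)"
    using n ln_div[of "real (Suc n)" "real n"] by (simp add: field_simps)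
  also have "\<dots> \<le> 1 / real n" by (rule ln_add_one_self_le_self) simp
  finally have "(ln (real (Suc n)) - ln (real n)) / 400 \<le> 1 / 4 * (real n / 4) * (1 / (25 * (real n)\<^sup>2))"
    using n by (simp add: power2_eq_square)
  also have "\<dots> \<le> (\<Sum>u\<in>?B. 1 / real u) * (\<Sum>v\<in>?O (Suc n). 1 / real v) * (1 / (25 * (real n)\<^sup>2))"
    using sum_inverse_odd_block_ge[of n] sum_inverse_odds_ge[of "Suc n"]
    by (intro mult_right_mono mult_mono) (auto intro!: sum_nonneg)
  also have "\<dots> = (\<Sum>u\<in>?B. \<Sum>v\<in>?O (Suc n). 1 / real u * (1 / real v) * (1 / (25 * (real n)\<^sup>2)))"
    by (simp only: sum_product) (simp only: sum_distrib_right)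
  also have "\<dots> \<le> (\<Sum>u\<in>?B. \<Sum>v\<in>?O (Suc n). pair_term k u v)"
    by (intro sum_mono term_ge) (auto simp: odds_below_def)
  finally have 1: "(ln (real (Suc n)) - ln (real n)) / 400
      \<le> (\<Sum>u\<in>?B. \<Sum>v\<in>?O (Suc n). pair_term k u v)" .
  have "(ln (real n) - ln (real k)) / 400 \<le> (\<Sum>u\<in>?O n. \<Sum>v\<in>?O n. pair_term k u v)"
    by (rule step.IH)
  \<comment> \<open>Pairs with \<open>u\<close> old and \<open>v\<close> in the new block enter only
    through their nonnegativity.\<close>
  also have "\<dots> \<le> (\<Sum>u\<in>?O n. \<Sum>v\<in>?O (Suc n). pair_term k u v)"
    by (intro sum_mono sum_mono2) (auto simp: odds_below_def pair_term_nonneg)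
  finally have 2: "(ln (real n) - ln (real k)) / 400 \<le> \<dots>" .
  have "(\<Sum>u\<in>?O (Suc n). \<Sum>v\<in>?O (Suc n). pair_term k u v)
      = (\<Sum>u\<in>?O n. \<Sum>v\<in>?O (Suc n). pair_term k u v) + (\<Sum>u\<in>?B. \<Sum>v\<in>?O (Suc n). pair_term k u v)"
    by (subst (1) odds_below_power_Suc(1), rule sum.union_disjoint) (auto simp: odds_below_def)
  thus ?case using 1 2 by (simp add: diff_divide_distrib)
qed

text \<open>Rankin's trick with factor 2.\<close>

lemma sum_pair_term_many_factors_le:
  assumes "n \<ge> 1" "k \<ge> 2"
  shows "(\<Sum>(u, v) | (u, v) \<in> odds_below (2 ^ n) \<times> odds_below (2 ^ n) \<and> big_omega (u * v) > k. pair_term k u v)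
      \<le> exp 48 * (real n + 1) ^ 12 / 2 ^ k"
proof -
  let ?O = "odds_below (2 ^ n)"
  have "(\<Sum>(u, v) | (u, v) \<in> ?O \<times> ?O \<and> big_omega (u * v) > k. pair_term k u v)
      \<le> (\<Sum>(u, v) | (u, v) \<in> ?O \<times> ?O \<and> big_omega (u * v) > k. weight 2 u * weight 2 v / 2 ^ k)"
  proof (rule sum_mono, clarify)
    fix u v assume "u \<in> ?O" "v \<in> ?O" and gt: "big_omega (u * v) > k"
    hence uv: "u > 0" "v > 0" using odds_below_pos by auto
    have "1 \<le> real k * ln 2" using ln2_bounds assms(2) mult_mono[of 2 "real k" "1 / 2" "ln 2"] by simp
    moreover have "0 \<le> ln (real (u * v))" using uv by (simp add: ln_mult)
    ultimately have "1 \<le> (ln (real (u * v)) + real k * ln 2)\<^sup>2"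
      by (intro one_le_power) linarith
    hence "pair_term k u v \<le> 1 / (real (u * v) * 1)"
      unfolding pair_term_def using uv
      by (intro divide_left_mono mult_left_mono mult_pos_pos[of _ "_ * 1"] mult_pos_pos) auto
    also have "\<dots> \<le> 1 / (real (u * v) * 1) * (2 ^ big_omega (u * v) / 2 ^ k)"
    proof -
      have "(2::real) ^ k \<le> 2 ^ big_omega (u * v)" using gt by (intro power_increasing) auto
      hence "1 \<le> (2::real) ^ big_omega (u * v) / 2 ^ k" by simp
      from mult_left_mono[OF this, of "1 / (real (u * v) * 1)"] show ?thesis by simp
    qed
    also have "\<dots> = weight 2 u * weight 2 v / 2 ^ k"
      using uv by (simp add: weight_def big_omega_mult power_add)
    finally show "pair_term k u v \<le> weight 2 u * weight 2 v / 2 ^ k" .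
  qed
  also have "\<dots> \<le> (\<Sum>(u, v)\<in>?O \<times> ?O. weight 2 u * weight 2 v / 2 ^ k)"
    by (intro sum_mono2) (auto simp: weight_nonneg)
  also have "\<dots> = (\<Sum>u\<in>?O. weight 2 u) * (\<Sum>u\<in>?O. weight 2 u) / 2 ^ k"
    by (simp add: sum_product sum.cartesian_product[symmetric] sum_divide_distrib)
  also have "\<dots> \<le> (exp 24 * (real n + 1) ^ 6) * (exp 24 * (real n + 1) ^ 6) / 2 ^ k"
    by (intro divide_right_mono mult_mono sum_weight_odds_le assms) (auto intro!: sum_nonneg weight_nonneg)
  also have "\<dots> = exp 48 * (real n + 1) ^ 12 / 2 ^ k"
  proof -
    have "exp 24 * exp 24 = exp (48::real)" by (simp add: exp_add[symmetric])
    moreover have "(real n + 1) ^ 6 * (real n + 1) ^ 6 = (real n + 1) ^ 12"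
      by (simp add: power_add[symmetric])
    moreover have "(a * b) * (a * b) = (a * a) * (b * b)" for a b :: real by simp
    ultimately show ?thesis by (simp only:)
  qed
  finally show ?thesis .
qed

text \<open>Multiplying each product \<open>m = u * v\<close> by the power of 2 that raises \<Omega>
  to \<open>k\<close> gives a primitive set. The pairs with product \<open>m\<close> number at most
  \<open>2 ^ \<Omega>(m)\<close>, the numerator left after these powers cancel.\<close>

lemma sum_pairs_le_primitive:
  assumes "finite O'" "\<And>u. u \<in> O' \<Longrightarrow> odd (u::nat)" "k \<ge> 1"
  shows "\<exists>A. finite A \<and> A \<subseteq> {2..} \<and> primitive_set A \<and>
      (\<Sum>(u, v) | (u, v) \<in> O' \<times> O' \<and> big_omega (u * v) \<le> k. pair_term k u v)
      \<le> (\<Sum>a\<in>A. 2 ^ big_omega a / (real a * ln (real a) powr 2))"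
proof -
  define S where "S = {(u, v). (u, v) \<in> O' \<times> O' \<and> big_omega (u * v) \<le> k}"
  have finS: "finite S" by (rule finite_subset[of _ "O' \<times> O'"]) (auto simp: S_def assms)
  define M where "M = (\<lambda>(u, v). u * v) ` S"
  have M: "odd m" "m > 0" "big_omega m \<le> k" if "m \<in> M" for m
  proof -
    show "odd m" using that assms(2) by (auto simp: M_def S_def)
    thus "m > 0" by (auto intro: gr0I)
    show "big_omega m \<le> k" using that by (auto simp: M_def S_def)
  qed
  define \<phi> where "\<phi> = (\<lambda>m. 2 ^ (k - big_omega m) * m)"
  have om: "big_omega (\<phi> m) = k" if "m \<in> M" for m
    using M[OF that] by (simp add: \<phi>_def big_omega_mult big_omega_power big_omega_prime)
  have \<phi>_pos: "\<phi> m > 0" if "m \<in> M" for m using M[OF that] by (simp add: \<phi>_def)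
  have \<phi>_ge: "\<phi> m \<ge> 2" if "m \<in> M" for m
  proof -
    have "\<phi> m \<noteq> 1" using om[OF that] assms(3) by auto
    thus ?thesis using \<phi>_pos[OF that] by linarith
  qed
  \<comment> \<open>\<open>m\<close> is recovered as the odd part of its image.\<close>
  have inj: "inj_on \<phi> M"
  proof (rule inj_onI)
    fix m m' assume m: "m \<in> M" "m' \<in> M" "\<phi> m = \<phi> m'"
    have "coprime m (2 ^ (k - big_omega m'))" "coprime m' (2 ^ (k - big_omega m))"
      using M(1)[OF m(1)] M(1)[OF m(2)] by auto
    moreover have "m dvd 2 ^ (k - big_omega m') * m'" "m' dvd 2 ^ (k - big_omega m) * m"
      using m(3) by (auto simp: \<phi>_def) (metis dvd_triv_right)+
    ultimately have "m dvd m'" "m' dvd m" using coprime_dvd_mult_right_iff by blast+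
    thus "m = m'" by (rule dvd_antisym)
  qed
  \<comment> \<open>A pair with product \<open>m\<close> is determined by its first entry, a divisor
    of \<open>m\<close>.\<close>
  have fibre: "card {x. x \<in> S \<and> (\<lambda>(u, v). u * v) x = m} \<le> 2 ^ big_omega m" if "m \<in> M" for m
  proof -
    have "card {x. x \<in> S \<and> (\<lambda>(u, v). u * v) x = m} \<le> card {d. d dvd m}"
      using M[OF that]
      by (intro card_inj_on_le[of fst]) (auto simp: inj_on_def)
    also have "\<dots> \<le> 2 ^ big_omega m" by (rule card_divisors_le) (use M[OF that] in auto)
    finally show ?thesis .
  qed
  define g where "g = (\<lambda>m. 1 / (real m * (ln (real m) + real k * ln 2)\<^sup>2))"
  have g0: "g m \<ge> 0" for m by (simp add: g_def)
  have "(\<Sum>(u, v)\<in>S. pair_term k u v) = (\<Sum>x\<in>S. g ((\<lambda>(u, v). u * v) x))"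
    by (intro sum.cong) (auto simp: pair_term_def g_def)
  also have "\<dots> = (\<Sum>m\<in>M. \<Sum>x | x \<in> S \<and> (\<lambda>(u, v). u * v) x = m. g ((\<lambda>(u, v). u * v) x))"
    unfolding M_def by (rule sum.image_gen[OF finS])
  also have "\<dots> = (\<Sum>m\<in>M. real (card {x. x \<in> S \<and> (\<lambda>(u, v). u * v) x = m}) * g m)"
    by (intro sum.cong) auto
  also have "\<dots> \<le> (\<Sum>m\<in>M. 2 ^ big_omega m * g m)"
  proof (intro sum_mono mult_right_mono g0)
    fix m assume "m \<in> M"
    from of_nat_mono[OF fibre[OF this], where 'a = real]
    show "real (card {x. x \<in> S \<and> (\<lambda>(u, v). u * v) x = m}) \<le> 2 ^ big_omega m" by simp
  qed
  also have "\<dots> \<le> (\<Sum>m\<in>M. 2 ^ big_omega (\<phi> m) / (real (\<phi> m) * ln (real (\<phi> m)) powr 2))"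
  proof (rule sum_mono)
    fix m assume m: "m \<in> M"
    have \<phi>: "real (\<phi> m) = 2 ^ (k - big_omega m) * real m" by (simp add: \<phi>_def)
    have "ln (real (\<phi> m)) = real (k - big_omega m) * ln 2 + ln (real m)"
      using M[OF m] by (simp add: \<phi> ln_mult ln_realpow)
    also have "\<dots> \<le> real k * ln 2 + ln (real m)"
      by (intro add_right_mono mult_right_mono) auto
    finally have le: "ln (real (\<phi> m)) \<le> ln (real m) + real k * ln 2" by simp
    have pos: "ln (real (\<phi> m)) > 0" using \<phi>_ge[OF m] by simp
    \<comment> \<open>Each adjoined factor 2 doubles numerator and denominator alike, so only the
      logarithm changes.\<close>
    have "(2::real) ^ k = 2 ^ big_omega m * 2 ^ (k - big_omega m)"
      using M[OF m] by (simp add: power_add[symmetric])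
    hence "2 ^ big_omega (\<phi> m) / (real (\<phi> m) * ln (real (\<phi> m)) powr 2)
        = 2 ^ big_omega m * (1 / (real m * (ln (real (\<phi> m)))\<^sup>2))"
      using pos by (simp add: om[OF m] \<phi> powr_realpow del: power_Suc)
    moreover have "g m \<le> 1 / (real m * (ln (real (\<phi> m)))\<^sup>2)"
      unfolding g_def using le pos M[OF m]
      by (intro divide_left_mono mult_left_mono power_mono mult_pos_pos) auto
    ultimately show "2 ^ big_omega m * g m \<le> 2 ^ big_omega (\<phi> m) / (real (\<phi> m) * ln (real (\<phi> m)) powr 2)"
      by (simp only: mult_left_mono zero_le_power zero_le_numeral)
  qed
  also have "\<dots> = (\<Sum>a\<in>\<phi> ` M. 2 ^ big_omega a / (real a * ln (real a) powr 2))"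
    by (simp add: sum.reindex[OF inj])
  finally have "(\<Sum>(u, v)\<in>S. pair_term k u v) \<le> \<dots>" .
  moreover have "finite (\<phi> ` M)" using finS by (simp add: M_def)
  moreover have "\<phi> ` M \<subseteq> {2..}" using \<phi>_ge by auto
  moreover have "primitive_set (\<phi> ` M)"
    unfolding primitive_set_def using om \<phi>_pos big_omega_dvd_eq by fastforce
  ultimately show ?thesis unfolding S_def by (intro exI[of _ "\<phi> ` M"]) auto
qed

text \<open>With \<open>n + 1 = 2 ^ r\<close> and \<open>k = 12 * r\<close>, Rankin's bound for the
  excluded pairs is exactly \<open>exp 48\<close>, while \<open>ln n - ln k\<close> grows linearly
  in \<open>r\<close>.\<close>

lemma exists_primitive_large:
  fixes C :: real
  shows "\<exists>A. finite A \<and> A \<subseteq> {2..} \<and> primitive_set A \<and>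
      (\<Sum>a\<in>A. 2 ^ big_omega a / (real a * ln (real a) powr 2)) > C"
proof -
  \<comment> \<open>Chosen to fit \<open>ln n - ln k \<ge> r / 4 - ln 48\<close>, which is derived
    below.\<close>
  obtain r0 :: nat where r0: "real r0 > 4 * (400 * (C + exp 48) + ln 48)"
    using reals_Archimedean2 by blast
  define r where "r = max r0 8"
  have r: "r \<ge> 8" "real r > 4 * (400 * (C + exp 48) + ln 48)" using r0 by (auto simp: r_def)
  define n k where "n = (2::nat) ^ r - 1" and "k = 12 * r"
  \<comment> \<open>This is \<open>k \<le> n\<close>, required for the lower bound of the full
    double sum.\<close>
  have "12 * r + 1 \<le> 2 ^ r" using r(1)
    by (induction r rule: dec_induct) auto
  hence nk: "n \<ge> k" "k \<ge> 2" "n \<ge> 1" "real n + 1 = 2 ^ r"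
    using r(1) by (auto simp: n_def k_def of_nat_diff)
  have "real (Suc n) = 2 * 2 ^ (r - 1)"
    using nk(4) r(1) by (subst power_Suc[symmetric]) simp
  moreover have "real (Suc n) \<le> 2 * real n" using nk(3) by simp
  ultimately have "2 ^ (r - 1) \<le> real n" by simp
  hence "ln (2 ^ (r - 1)) \<le> ln (real n)" using nk(3) by (subst ln_le_cancel_iff) auto
  hence 1: "(real r - 1) * ln 2 \<le> ln (real n)" using r(1) by (simp add: ln_realpow of_nat_diff)
  have "(real r - 1) * (1 / 2) \<le> (real r - 1) * ln 2" using ln2_bounds r(1) by (intro mult_left_mono) auto
  hence "ln (real n) \<ge> real r / 2 - 1 / 2" using 1 by simp
  \<comment> \<open>Writing \<open>12 * r\<close> as \<open>48 * (r / 4)\<close> makes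
    \<open>ln x \<le> x - 1\<close> cost only \<open>r / 4\<close> against the gain
    \<open>r / 2\<close>.\<close>
  moreover have "ln (real k) = ln 48 + ln (real r / 4)"
    using r(1) ln_mult[of 48 "real r / 4"] by (simp add: k_def)
  moreover have "ln (real r / 4) \<le> real r / 4 - 1" using r(1) by (intro ln_le_minus_one) simp
  ultimately have "(ln (real n) - ln (real k)) / 400 > C + exp 48" using r(2) by simp
  let ?O = "odds_below (2 ^ n)"
  let ?good = "{(u, v). (u, v) \<in> ?O \<times> ?O \<and> big_omega (u * v) \<le> k}"
  let ?bad = "{(u, v). (u, v) \<in> ?O \<times> ?O \<and> big_omega (u * v) > k}"
  have "C + exp 48 < (ln (real n) - ln (real k)) / 400" by fact
  also have "\<dots> \<le> (\<Sum>u\<in>?O. \<Sum>v\<in>?O. pair_term k u v)"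
    by (rule sum_pair_term_ge) (use nk in auto)
  also have "\<dots> = (\<Sum>(u, v)\<in>?good \<union> ?bad. pair_term k u v)"
    unfolding sum.cartesian_product by (intro sum.cong) auto
  also have "\<dots> = (\<Sum>(u, v)\<in>?good. pair_term k u v) + (\<Sum>(u, v)\<in>?bad. pair_term k u v)"
    by (rule sum.union_disjoint) (auto intro: finite_subset[of _ "?O \<times> ?O"])
  also have "(\<Sum>(u, v)\<in>?bad. pair_term k u v) \<le> exp 48 * (real n + 1) ^ 12 / 2 ^ k"
    by (rule sum_pair_term_many_factors_le) (use nk in auto)
  also have "\<dots> = exp 48"
    by (simp add: nk(4) k_def power_mult[symmetric] mult.commute)
  finally have "C < (\<Sum>(u, v)\<in>?good. pair_term k u v)" by simp
  moreover have "odd u" if "u \<in> ?O" for u using that by (simp add: odds_below_def)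
  hence "\<exists>A. finite A \<and> A \<subseteq> {2..} \<and> primitive_set A \<and>
      (\<Sum>(u, v)\<in>?good. pair_term k u v) \<le> (\<Sum>a\<in>A. 2 ^ big_omega a / (real a * ln (real a) powr 2))"
    using nk by (intro sum_pairs_le_primitive) simp_all
  ultimately show ?thesis using less_le_trans by blast
qed

section \<open>The supremum\<close>

lemma U_sup_ge:
  assumes "finite A" "A \<subseteq> {2..}" "primitive_set A" "z > 0"
  shows "ennreal (\<Sum>a\<in>A. z ^ big_omega a / (real a * ln (real a) powr z)) \<le> U_sup z"
proof -
  have "ennreal (\<Sum>a\<in>A. z ^ big_omega a / (real a * ln (real a) powr z)) = f_val z A"
    unfolding f_val_def using assms by (simp add: sum_ennreal)
  also have "\<dots> \<le> U_sup z" unfolding U_sup_def by (rule SUP_upper) (use assms in auto)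
  finally show ?thesis .
qed

lemma ennreal_eq_top_if_unbounded:
  assumes "\<And>C::real. ennreal C \<le> x"
  shows "x = \<infinity>"
proof (cases x)
  case (real r)
  thus ?thesis using assms[of "r + 1"] by (simp add: ennreal_le_iff)
qed simp

lemma U_sup_2: "U_sup 2 = \<infinity>"
proof (rule ennreal_eq_top_if_unbounded)
  fix C :: real
  obtain A where A: "finite A" "A \<subseteq> {2..}" "primitive_set A"
    "(\<Sum>a\<in>A. 2 ^ big_omega a / (real a * ln (real a) powr 2)) > C"
    using exists_primitive_large by blast
  have "ennreal C \<le> ennreal (\<Sum>a\<in>A. 2 ^ big_omega a / (real a * ln (real a) powr 2))"
    using A(4) by (intro ennreal_leI) simp
  also have "\<dots> \<le> U_sup 2" using U_sup_ge[OF A(1-3), of 2] by simp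
  finally show "ennreal C \<le> U_sup 2" .
qed

text \<open>The singleton of \<open>2 ^ k\<close> contributes
  \<open>(z / 2) ^ k / (k * ln 2) powr z\<close>, exponential over polynomial growth in
  \<open>k\<close>.\<close>

lemma U_sup_greater_2:
  assumes "z > 2"
  shows "U_sup z = \<infinity>"
proof (rule ennreal_eq_top_if_unbounded)
  fix C :: real
  define d where "d = ln (z / 2)"
  \<comment> \<open>The exponent is rounded up to reduce to natural powers against
    \<open>exp\<close>.\<close>
  define m where "m = nat \<lceil>z\<rceil>"
  have d: "d > 0" using assms by (simp add: d_def)
  have m: "z \<le> real m" unfolding m_def by linarith
  have "filterlim (\<lambda>k. real k * d) at_top sequentially"
    by (rule filterlim_at_top_mult_tendsto_pos[OF tendsto_const d filterlim_real_sequentially])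
  hence "(\<lambda>k. (real k * d) ^ m / exp (real k * d)) \<longlonglongrightarrow> 0"
    by (rule filterlim_compose[OF tendsto_power_div_exp_0])
  \<comment> \<open>With this threshold \<open>d ^ m\<close> cancels, leaving
    \<open>k ^ m * (\<bar>C\<bar> + 1) < (z / 2) ^ k\<close>; the \<open>+ 1\<close> keeps the
    denominator positive.\<close>
  hence "eventually (\<lambda>k. (real k * d) ^ m / exp (real k * d) < d ^ m / (\<bar>C\<bar> + 1)) sequentially"
    by (rule order_tendstoD) (use d in \<open>auto intro: divide_pos_pos\<close>)
  hence "eventually (\<lambda>k. (real k * d) ^ m / exp (real k * d) < d ^ m / (\<bar>C\<bar> + 1) \<and> k \<ge> 1) sequentially"
    by (rule eventually_conj) (rule eventually_ge_at_top)
  then obtain k where k: "(real k * d) ^ m / exp (real k * d) < d ^ m / (\<bar>C\<bar> + 1)" "k \<ge> 1"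
    by (auto dest: eventually_happens)
  have "exp (real k * d) = (z / 2) ^ k"
    using assms by (simp add: d_def exp_of_nat_mult)
  moreover have "d ^ m * (real k ^ m * (\<bar>C\<bar> + 1)) < d ^ m * exp (real k * d)"
    using k(1) by (simp add: field_simps power_mult_distrib)
  ultimately have "d ^ m * (real k ^ m * (\<bar>C\<bar> + 1)) < d ^ m * (z / 2) ^ k" by simp
  hence exp_ge: "real k ^ m * (\<bar>C\<bar> + 1) < (z / 2) ^ k" using d by simp
  have "real k * ln 2 \<le> real k * 1" using ln2_bounds by (intro mult_left_mono) auto
  hence "(real k * ln 2) powr z \<le> real k powr z" using assms by (intro powr_mono2) auto
  also have "\<dots> \<le> real k powr real m" using k(2) m by (intro powr_mono) auto
  also have "\<dots> = real k ^ m" using k(2) by (simp add: powr_realpow)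
  finally have "(real k * ln 2) powr z * (\<bar>C\<bar> + 1) \<le> real k ^ m * (\<bar>C\<bar> + 1)"
    by (intro mult_right_mono) auto
  with exp_ge have "(\<bar>C\<bar> + 1) \<le> (z / 2) ^ k / (real k * ln 2) powr z"
    using k(2) by (simp add: pos_le_divide_eq mult.commute)
  hence C_le: "(z / 2) ^ k / (real k * ln 2) powr z \<ge> C" by linarith
  have "(2::nat) ^ 1 \<le> 2 ^ k" using k(2) by (intro power_increasing) auto
  hence *: "ennreal (\<Sum>a\<in>{2 ^ k}. z ^ big_omega a / (real a * ln (real a) powr z)) \<le> U_sup z"
    using assms by (intro U_sup_ge) (auto simp: primitive_set_def)
  have "C \<le> (\<Sum>a\<in>{2 ^ k}. z ^ big_omega a / (real a * ln (real a) powr z))"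
    using C_le k(2) by (simp add: big_omega_power big_omega_prime ln_realpow power_divide)
  with * show "ennreal C \<le> U_sup z" using ennreal_leI order.trans by blast
qed

text \<open>A finite primitive set whose sum at 2 exceeds \<open>C\<close> still does so just left
  of 2, by continuity of the finite sum in \<open>z\<close>.\<close>

lemma U_sup_tendsto: "(U_sup \<longlongrightarrow> \<infinity>) (at_left 2)"
  unfolding infinity_ennreal_def tendsto_top_iff_ennreal
proof (intro allI impI)
  fix C :: real assume "C \<ge> 0"
  obtain A where A: "finite A" "A \<subseteq> {2..}" "primitive_set A"
    "(\<Sum>a\<in>A. 2 ^ big_omega a / (real a * ln (real a) powr 2)) > C"
    using exists_primitive_large by blast
  let ?f = "\<lambda>z::real. \<Sum>a\<in>A. z ^ big_omega a / (real a * ln (real a) powr z)"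
  have "(?f \<longlongrightarrow> ?f 2) (at_left 2)"
  proof (rule tendsto_sum)
    fix a assume "a \<in> A"
    hence "a \<ge> 2" using A(2) by auto
    hence "real a > 0" "ln (real a) > 0" by simp_all
    thus "((\<lambda>z. z ^ big_omega a / (real a * ln (real a) powr z)) \<longlongrightarrow>
        2 ^ big_omega a / (real a * ln (real a) powr 2)) (at_left 2)"
      by (intro tendsto_intros) simp_all
  qed
  hence "eventually (\<lambda>z. ?f z > C) (at_left 2)"
    using A(4) by (rule order_tendstoD)
  moreover have "eventually (\<lambda>z::real. z > 0) (at_left 2)"
    by (rule eventually_at_leftI[of 0]) auto
  ultimately show "eventually (\<lambda>z. ennreal C < U_sup z) (at_left 2)"
  proof eventually_elim
    case (elim z)
    have "ennreal C < ennreal (?f z)" using elim(1) \<open>C \<ge> 0\<close> by (intro ennreal_lessI) auto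
    also have "\<dots> \<le> U_sup z" by (rule U_sup_ge) (use A elim in auto)
    finally show ?case .
  qed
qed

theorem theorem3:
  shows "(\<forall>\<epsilon>::real. \<epsilon> > 0 \<longrightarrow> (\<exists>B::real. \<forall>z\<in>{0<..2 - \<epsilon>}. U_sup z \<le> ennreal B))
       \<and> (\<forall>z::real. z \<ge> 2 \<longrightarrow> U_sup z = \<infinity>)
       \<and> (U_sup \<longlongrightarrow> \<infinity>) (at_left 2)"
proof (intro conjI allI impI)
  fix \<epsilon> :: real assume "\<epsilon> > 0"
  have "U_sup z \<le> ennreal (18 * exp 32 / \<epsilon>)" if "z \<in> {0<..2 - \<epsilon>}" for z
    unfolding U_sup_def using that \<open>\<epsilon> > 0\<close> by (intro SUP_least f_val_le) auto
  thus "\<exists>B::real. \<forall>z\<in>{0<..2 - \<epsilon>}. U_sup z \<le> ennreal B" by blast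
next
  fix z :: real assume "z \<ge> 2"
  thus "U_sup z = \<infinity>" using U_sup_2 U_sup_greater_2 by (cases "z = 2") auto
qed (rule U_sup_tendsto)

end
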